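(* Let $\mathbb{F}$ be an algebraically closed field with $\mathrm{Char}(\mathbb{F})\neq 2$, let $L=\mathfrak{sl}_2(\mathbb{F})$, and let $a,a^*$ be normalized semisimple elements of $L$ that generate $L$ as a Lie algebra. Then there exists a unique antiautomorphism of $L$ that fixes each of $a$, $a^*$. Denoting this antiautomorphism by $\dagger$, we have $(y^\dagger)^\dagger=y$ for all $y\in L$.
   Context: $L=\mathfrak{sl}_2(\mathbb{F})$ is the Lie algebra of trace-zero $2\times 2$ matrices over $\mathbb{F}$ with bracket $[u,v]=uv-vu$. The bilinear form $\langle u,v\rangle$ on $L$ is $\frac18$ times the Killing form; equivalently $\langle u,v\rangle=\mathrm{tr}(uv)/2$. An element $u\in L$ is semisimple if $\mathrm{ad}\,u:L\to L$ is diagonalizable; a semisimple $u$ is normalized if $\langle u,u\rangle=1$. An antiautomorphism of $L$ is an isomorphism of $\mathbb{F}$-vector spaces $\sigma:L\to L$ such that $[y,z]^\sigma=[z^\sigma,y^\sigma]$ for all $y,z\in L$. *)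

theory Defs
  imports "HOL-Analysis.Analysis"
begin

section \<open>The vector space of trace-zero matrices\<close>

typedef (overloaded) 'a sl2 = "{A :: 'a::field ^ 2 ^ 2. trace A = 0}"
  morphisms mat_of_sl2 Abs_sl2
  by (rule exI[of _ 0]) (simp add: trace_def)

setup_lifting type_definition_sl2

instantiation sl2 :: (field) ab_group_add
begin
lift_definition zero_sl2 :: "'a sl2" is 0
  by (simp add: trace_def)
lift_definition plus_sl2 :: "'a sl2 \<Rightarrow> 'a sl2 \<Rightarrow> 'a sl2" is "(+)"
  by (simp add: trace_add)
lift_definition minus_sl2 :: "'a sl2 \<Rightarrow> 'a sl2 \<Rightarrow> 'a sl2" is "(-)"
  by (simp add: trace_sub)
lift_definition uminus_sl2 :: "'a sl2 \<Rightarrow> 'a sl2" is uminus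
  by (simp add: trace_def sum_negf)
instance
  by standard (transfer; simp)+
end

lift_definition scale_sl2 :: "'a::field \<Rightarrow> 'a sl2 \<Rightarrow> 'a sl2"
  is "\<lambda>c A. \<chi> i j. c * A $ i $ j"
  by (simp add: trace_def flip: sum_distrib_left)

interpretation sl2: vector_space scale_sl2
  by standard (transfer; simp add: vec_eq_iff algebra_simps)+

section \<open>The Lie algebra structure\<close>

lift_definition lie_bracket :: "'a::field sl2 \<Rightarrow> 'a sl2 \<Rightarrow> 'a sl2"
  is "\<lambda>A B. A ** B - B ** A"
  by (metis trace_sub trace_mul_sym diff_self)

abbreviation ad :: "'a::field sl2 \<Rightarrow> 'a sl2 \<Rightarrow> 'a sl2"
  where "ad u \<equiv> lie_bracket u"

definition lie_subalgebra :: "'a::field sl2 set \<Rightarrow> bool"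
  where "lie_subalgebra S \<longleftrightarrow>
    sl2.subspace S \<and> (\<forall>u\<in>S. \<forall>v\<in>S. lie_bracket u v \<in> S)"

text \<open>\<open>lie_subalgebra hull X\<close> is the intersection of all Lie subalgebras containing \<open>X\<close>.\<close>

definition lie_generates :: "'a::field sl2 set \<Rightarrow> bool"
  where "lie_generates X \<longleftrightarrow> lie_subalgebra hull X = UNIV"

definition lie_antiautomorphism :: "('a::field sl2 \<Rightarrow> 'a sl2) \<Rightarrow> bool"
  where "lie_antiautomorphism \<sigma> \<longleftrightarrow>
    Vector_Spaces.linear scale_sl2 scale_sl2 \<sigma> \<and> bij \<sigma> \<and>
    (\<forall>y z. \<sigma> (lie_bracket y z) = lie_bracket (\<sigma> z) (\<sigma> y))"

section \<open>Semisimple and normalized elements\<close>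

definition diagonalizable :: "('a::field sl2 \<Rightarrow> 'a sl2) \<Rightarrow> bool"
  where "diagonalizable T \<longleftrightarrow>
    (\<exists>B. sl2.independent B \<and> sl2.span B = UNIV \<and> (\<forall>v\<in>B. \<exists>c. T v = scale_sl2 c v))"

definition semisimple :: "'a::field sl2 \<Rightarrow> bool"
  where "semisimple u \<longleftrightarrow> diagonalizable (ad u)"

lift_definition sl2_e :: "'a::field sl2" is "vector [vector [0, 1], vector [0, 0]]"
  by (simp add: trace_def sum_2)

lift_definition sl2_f :: "'a::field sl2" is "vector [vector [0, 0], vector [1, 0]]"
  by (simp add: trace_def sum_2)

lift_definition sl2_h :: "'a::field sl2" is "vector [vector [1, 0], vector [0, - 1]]"
  by (simp add: trace_def sum_2)

definition sl2_basis :: "'a::field sl2 set"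
  where "sl2_basis = {sl2_e, sl2_f, sl2_h}"

definition endo_trace :: "('a::field sl2 \<Rightarrow> 'a sl2) \<Rightarrow> 'a"
  where "endo_trace T = (\<Sum>b\<in>sl2_basis. sl2.representation sl2_basis (T b) b)"

definition killing_form :: "'a::field sl2 \<Rightarrow> 'a sl2 \<Rightarrow> 'a"
  where "killing_form u v = endo_trace (ad u \<circ> ad v)"

text \<open>
  In characteristic 2 the factor \<open>1 / 8\<close> is the junk value \<open>0\<close>; that characteristic is to be
  excluded whenever the form is used.
\<close>

definition sl2_form :: "'a::field sl2 \<Rightarrow> 'a sl2 \<Rightarrow> 'a"
  where "sl2_form u v = killing_form u v / 8"

definition normalized :: "'a::field sl2 \<Rightarrow> bool"
  where "normalized u \<longleftrightarrow> sl2_form u u = 1"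

section \<open>The form as a matrix trace\<close>

lemma sl2_decomp:
  "u = scale_sl2 (mat_of_sl2 u $ 1 $ 2) sl2_e + scale_sl2 (mat_of_sl2 u $ 2 $ 1) sl2_f
     + scale_sl2 (mat_of_sl2 u $ 1 $ 1) sl2_h"
  by transfer (auto simp: vec_eq_iff forall_2 trace_def sum_2 eq_neg_iff_add_eq_0 add.commute)

lemma sl2_basis_distinct: "sl2_e \<noteq> sl2_f" "sl2_e \<noteq> sl2_h" "sl2_f \<noteq> sl2_h"
  by (transfer; simp add: vec_eq_iff forall_2)+

lemma sum_sl2_basis: "(\<Sum>b\<in>sl2_basis. g b) = g sl2_e + g sl2_f + g sl2_h"
  by (simp add: sl2_basis_def sl2_basis_distinct add.assoc)

lemma sl2_comb_eq_0:
  assumes "scale_sl2 x sl2_e + scale_sl2 y sl2_f + scale_sl2 z sl2_h = 0"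
  shows "x = 0 \<and> y = 0 \<and> z = 0"
  using assms by transfer (auto simp: vec_eq_iff forall_2)

lemma finite_sl2_basis: "finite sl2_basis"
  by (simp add: sl2_basis_def)

lemma sl2_basis_independent: "sl2.independent sl2_basis"
proof -
  have "\<forall>b\<in>sl2_basis. g b = 0" if "(\<Sum>b\<in>sl2_basis. scale_sl2 (g b) b) = 0" for g
    using that sl2_comb_eq_0[of "g sl2_e" "g sl2_f" "g sl2_h"]
    unfolding sum_sl2_basis by (auto simp: sl2_basis_def)
  then show ?thesis
    by (auto simp: sl2.independent_explicit_finite_subsets sl2.dependent_finite[OF finite_sl2_basis])
qed

lemma sl2_basis_span: "sl2.span sl2_basis = UNIV"
proof -
  have "u \<in> sl2.span sl2_basis" for u
    by (subst sl2_decomp[of u])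
      (intro sl2.span_add sl2.span_scale sl2.span_base; simp add: sl2_basis_def)
  then show ?thesis by auto
qed

lemma representation_sl2_basis:
  "sl2.representation sl2_basis u sl2_e = mat_of_sl2 u $ 1 $ 2"
  "sl2.representation sl2_basis u sl2_f = mat_of_sl2 u $ 2 $ 1"
  "sl2.representation sl2_basis u sl2_h = mat_of_sl2 u $ 1 $ 1"
proof -
  let ?r = "sl2.representation sl2_basis u"
  have "(\<Sum>b\<in>sl2_basis. scale_sl2 (?r b) b) = u"
    by (rule sl2.sum_representation_eq)
      (auto simp: sl2_basis_independent sl2_basis_span finite_sl2_basis)
  then have u: "u = scale_sl2 (?r sl2_e) sl2_e + scale_sl2 (?r sl2_f) sl2_f + scale_sl2 (?r sl2_h) sl2_h"
    by (simp add: sum_sl2_basis)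
  have *: "mat_of_sl2 (scale_sl2 x sl2_e + scale_sl2 y sl2_f + scale_sl2 z sl2_h) $ 1 $ 2 = x"
    "mat_of_sl2 (scale_sl2 x sl2_e + scale_sl2 y sl2_f + scale_sl2 z sl2_h) $ 2 $ 1 = y"
    "mat_of_sl2 (scale_sl2 x sl2_e + scale_sl2 y sl2_f + scale_sl2 z sl2_h) $ 1 $ 1 = z" for x y z
    by (transfer; simp)+
  show "?r sl2_e = mat_of_sl2 u $ 1 $ 2" "?r sl2_f = mat_of_sl2 u $ 2 $ 1"
    "?r sl2_h = mat_of_sl2 u $ 1 $ 1"
    using * u by metis+
qed

lemma killing_form_eq_trace:
  "killing_form u v = 4 * trace (mat_of_sl2 u ** mat_of_sl2 v)"
  unfolding killing_form_def endo_trace_def sum_sl2_basis representation_sl2_basis o_def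
  apply transfer
  subgoal for u v
    apply (subgoal_tac "u $ 2 $ 2 = - u $ 1 $ 1 \<and> v $ 2 $ 2 = - v $ 1 $ 1")
     apply (simp add: matrix_matrix_mult_def trace_def sum_2 algebra_simps)
    apply (simp add: trace_def sum_2 eq_neg_iff_add_eq_0 add.commute)
    done
  done

lemma sl2_form_eq_trace:
  fixes u v :: "'a::field sl2"
  assumes "CHAR('a) \<noteq> 2"
  shows "sl2_form u v = trace (mat_of_sl2 u ** mat_of_sl2 v) / 2"
proof -
  have "(2::'a) \<noteq> 0"
  proof
    assume "(2::'a) = 0"
    then have "of_nat 2 = (0::'a)" by simp
    then have "CHAR('a) dvd 2" by (simp only: of_nat_eq_0_iff_char_dvd)
    moreover have "CHAR('a) \<noteq> 1" by (metis of_nat_1 of_nat_CHAR one_neq_zero)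
    ultimately show False using assms
      by (metis prime_nat_iff two_is_prime_nat)
  qed
  moreover have "(8::'a) = 4 * 2" "(4::'a) = 2 * 2" by simp_all
  ultimately show ?thesis
    unfolding sl2_form_def killing_form_eq_trace by (metis divide_divide_eq_left mult_eq_0_iff nonzero_mult_div_cancel_left)
qed

end

theory Submission
  imports Defs
begin

text \<open>
  Since \<open>c = [a, a']\<close> is orthogonal to \<open>a\<close> and \<open>a'\<close> for the trace form, the orthogonal
  reflection that negates \<open>c\<close> fixes \<open>a\<close> and \<open>a'\<close>; being \<open>y \<mapsto> - c y c\<^sup>-\<^sup>1\<close>, it is an
  antiautomorphism. It exists unless \<open>c\<close> is isotropic, in which case the orthogonal complement
  of \<open>c\<close> is a Lie subalgebra containing \<open>a\<close> and \<open>a'\<close>; this forces \<open>c = 0\<close>, and then \<open>a\<close> is central,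
  contradicting \<open>\<langle>a, a\<rangle> = 1\<close>. Two antiautomorphisms agree on a Lie subalgebra, so one fixing the generators is this reflection.
\<close>

lemma mat_of_sl2_22: "mat_of_sl2 u $ 2 $ 2 = - mat_of_sl2 u $ 1 $ 1"
  by transfer (simp add: trace_def sum_2 eq_neg_iff_add_eq_0 add.commute)

lemma sl2_eq_iff:
  "u = v \<longleftrightarrow> mat_of_sl2 u $ 1 $ 1 = mat_of_sl2 v $ 1 $ 1 \<and>
    mat_of_sl2 u $ 1 $ 2 = mat_of_sl2 v $ 1 $ 2 \<and> mat_of_sl2 u $ 2 $ 1 = mat_of_sl2 v $ 2 $ 1"
  by (metis sl2_decomp)

lemma mat_of_sl2_lie_bracket:
  "mat_of_sl2 (lie_bracket u v) $ 1 $ 1 =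
    mat_of_sl2 u $ 1 $ 2 * mat_of_sl2 v $ 2 $ 1 - mat_of_sl2 u $ 2 $ 1 * mat_of_sl2 v $ 1 $ 2"
  "mat_of_sl2 (lie_bracket u v) $ 1 $ 2 =
    2 * (mat_of_sl2 u $ 1 $ 1 * mat_of_sl2 v $ 1 $ 2 - mat_of_sl2 u $ 1 $ 2 * mat_of_sl2 v $ 1 $ 1)"
  "mat_of_sl2 (lie_bracket u v) $ 2 $ 1 =
    2 * (mat_of_sl2 u $ 2 $ 1 * mat_of_sl2 v $ 1 $ 1 - mat_of_sl2 u $ 1 $ 1 * mat_of_sl2 v $ 2 $ 1)"
  by (simp_all add: lie_bracket.rep_eq matrix_matrix_mult_def sum_2 mat_of_sl2_22 algebra_simps)

lemma mat_of_sl2_arith: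
  "mat_of_sl2 0 $ i $ j = 0"
  "mat_of_sl2 (u + v) $ i $ j = mat_of_sl2 u $ i $ j + mat_of_sl2 v $ i $ j"
  "mat_of_sl2 (u - v) $ i $ j = mat_of_sl2 u $ i $ j - mat_of_sl2 v $ i $ j"
  "mat_of_sl2 (scale_sl2 k u) $ i $ j = k * mat_of_sl2 u $ i $ j"
  by (simp_all add: zero_sl2.rep_eq plus_sl2.rep_eq minus_sl2.rep_eq scale_sl2.rep_eq)

text \<open>The Killing form is four times this one. Without the division in
  \<open>sl2_form\<close>, identities become polynomial in the matrix entries.\<close>

definition trace_form :: "'a::field sl2 \<Rightarrow> 'a sl2 \<Rightarrow> 'a"
  where "trace_form u v = trace (mat_of_sl2 u ** mat_of_sl2 v)"

lemma trace_form_coords: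
  "trace_form u v = 2 * mat_of_sl2 u $ 1 $ 1 * mat_of_sl2 v $ 1 $ 1
    + mat_of_sl2 u $ 1 $ 2 * mat_of_sl2 v $ 2 $ 1 + mat_of_sl2 u $ 2 $ 1 * mat_of_sl2 v $ 1 $ 2"
  by (simp add: trace_form_def matrix_matrix_mult_def trace_def sum_2 mat_of_sl2_22)

lemmas sl2_coords = mat_of_sl2_lie_bracket mat_of_sl2_arith trace_form_coords

lemma trace_form_lie_bracket:
  "trace_form (lie_bracket u v) u = 0" "trace_form (lie_bracket u v) v = 0"
  unfolding sl2_coords by algebra+

lemma trace_form_linear:
  "trace_form u 0 = 0"
  "trace_form u (x + y) = trace_form u x + trace_form u y"
  "trace_form u (x - y) = trace_form u x - trace_form u y"
  "trace_form u (scale_sl2 k y) = k * trace_form u y"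
  by (simp_all add: trace_form_coords mat_of_sl2_arith algebra_simps)

text \<open>Pairing with \<open>sl2_e\<close>, \<open>sl2_f\<close> and \<open>sl2_h\<close> reads
  off the entries of \<open>c\<close>, the diagonal one doubled, hence the condition on 2.\<close>

lemma trace_form_nondegenerate:
  assumes "(2::'a::field) \<noteq> 0" "\<And>y :: 'a sl2. trace_form c y = 0"
  shows "c = 0"
proof -
  have "mat_of_sl2 c $ 2 $ 1 = 0" "mat_of_sl2 c $ 1 $ 2 = 0" "2 * mat_of_sl2 c $ 1 $ 1 = 0"
    using assms(2)[of sl2_e] assms(2)[of sl2_f] assms(2)[of sl2_h]
    by (simp_all add: trace_form_coords sl2_e.rep_eq sl2_f.rep_eq sl2_h.rep_eq)
  then show ?thesis
    using assms(1) by (simp add: sl2_eq_iff mat_of_sl2_arith)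
qed

lemma lie_bracket_linear:
  "lie_bracket u (x + y) = lie_bracket u x + lie_bracket u y"
  "lie_bracket u (scale_sl2 k y) = scale_sl2 k (lie_bracket u y)"
  unfolding sl2_eq_iff sl2_coords by (intro conjI; algebra)+

lemma lie_bracket_0_right: "lie_bracket u 0 = 0"
  by (simp add: sl2_eq_iff sl2_coords)

lemma lie_bracket_jacobi:
  "lie_bracket u (lie_bracket x y) =
    lie_bracket (lie_bracket u x) y + lie_bracket x (lie_bracket u y)"
  unfolding sl2_eq_iff sl2_coords by (intro conjI; algebra)

lemma lie_bracket_0_left: "lie_bracket 0 u = 0"
  by (simp add: sl2_eq_iff sl2_coords)

lemma lie_generates_induct:
  assumes "lie_generates X" "X \<subseteq> S" "lie_subalgebra S"
  shows "S = UNIV"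
  using assms hull_minimal[of X S lie_subalgebra] by (auto simp: lie_generates_def)

text \<open>Closure under brackets is the derivation property of \<open>ad u\<close>, which is
  \<open>lie_bracket_jacobi\<close>.\<close>

lemma lie_subalgebra_centralizer: "lie_subalgebra {y. lie_bracket u y = 0}"
  unfolding lie_subalgebra_def sl2.subspace_def
  by (simp add: lie_bracket_0_left lie_bracket_0_right lie_bracket_linear lie_bracket_jacobi)

text \<open>Up to a constant, \<open>(trace_form c [y, z])\<^sup>2\<close> is the Gram determinant of \<open>c, y, z\<close>.\<close>

lemma lie_subalgebra_isotropic_orthogonal:
  assumes "trace_form c c = 0"
  shows "lie_subalgebra {y. trace_form c y = 0}"
proof -
  have "trace_form c (lie_bracket y z) = 0" if "trace_form c y = 0" "trace_form c z = 0" for y z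
  proof -
    have "(trace_form c (lie_bracket y z))\<^sup>2 =
      trace_form c y * (trace_form c y * trace_form z z - trace_form c z * trace_form y z) * 2
      - 2 * trace_form c z * (trace_form c y * trace_form z y - trace_form c z * trace_form y y)
      - 2 * trace_form c c * (trace_form y y * trace_form z z - (trace_form y z)\<^sup>2)"
      unfolding sl2_coords by algebra
    then show ?thesis using that assms by simp
  qed
  then show ?thesis
    by (simp add: lie_subalgebra_def sl2.subspace_def trace_form_linear)
qed

lemma trace_form_commutator_neq_0:
  assumes "lie_generates {a, a'}" "normalized a"
  shows "trace_form (lie_bracket a a') (lie_bracket a a') \<noteq> 0"
proof
  let ?c = "lie_bracket a a'"
  have four: "4 * trace_form a a / 8 = 1"
    using assms(2) by (simp add: normalized_def sl2_form_def killing_form_eq_trace trace_form_def)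
  \<comment> \<open>If 2 = 0, the numerator in \<open>four\<close> is 0, and so is the quotient,
    even over the vanishing 8.\<close>
  then have two: "(2::'a) \<noteq> 0"
    by (metis div_0 mult_2 mult_zero_left numeral_Bit0 add_0 zero_neq_one)
  assume "trace_form ?c ?c = 0"
  then have "{y. trace_form ?c y = 0} = UNIV"
    by (intro lie_generates_induct[OF assms(1)] lie_subalgebra_isotropic_orthogonal)
      (simp_all add: trace_form_lie_bracket)
  then have "?c = 0"
    using trace_form_nondegenerate[OF two] by auto
  \<comment> \<open>The centralizer of \<open>a\<close> contains \<open>a\<close> itself, and
    \<open>a'\<close> because \<open>?c = 0\<close>.\<close>
  then have "{y. lie_bracket a y = 0} = UNIV"
    by (intro lie_generates_induct[OF assms(1)] lie_subalgebra_centralizer)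
      (simp add: sl2_eq_iff sl2_coords)
  then have "ad a \<circ> ad a = (\<lambda>_. 0)"
    by (auto simp: fun_eq_iff)
  then have "killing_form a a = 0"
    by (simp add: killing_form_def endo_trace_def sum_sl2_basis representation_sl2_basis mat_of_sl2_arith)
  then show False
    using assms(2) by (simp add: normalized_def sl2_form_def)
qed

text \<open>The orthogonal reflection in the plane perpendicular to \<open>c\<close>; for isotropic
  \<open>c\<close>, division by zero turns it into the identity.\<close>

definition reflect :: "'a::field sl2 \<Rightarrow> 'a sl2 \<Rightarrow> 'a sl2"
  where "reflect c y = y - scale_sl2 (2 * trace_form c y / trace_form c c) c"

lemma reflect_eq_self: "trace_form c y = 0 \<Longrightarrow> reflect c y = y"
  by (simp add: reflect_def)

text \<open>The first reflection negates the pairing with \<open>c\<close>, so the second restores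
  the multiple of \<open>c\<close> that was subtracted.\<close>

lemma reflect_reflect:
  assumes "trace_form c c \<noteq> 0"
  shows "reflect c (reflect c y) = y"
proof -
  have "trace_form c (reflect c y) = - trace_form c y"
    using assms by (simp add: reflect_def trace_form_linear)
  then show ?thesis
    by (simp add: reflect_def[of c "reflect c y"]) (simp add: reflect_def)
qed

text \<open>Viewing the bracket as a cross product, this is the result of expanding
  \<open>c x (c x (y x z))\<close> in two ways.\<close>

lemma lie_bracket_gram:
  "scale_sl2 (trace_form c c) (lie_bracket y z) =
    scale_sl2 (trace_form c y) (lie_bracket c z) - scale_sl2 (trace_form c z) (lie_bracket c y)
    + scale_sl2 (trace_form c (lie_bracket y z)) c"
  unfolding sl2_eq_iff sl2_coords by (intro conjI; algebra)

text \<open>Expanding both sides with \<open>[c, c] = 0\<close> reduces the claim to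
  \<open>lie_bracket_gram\<close>, doubled and divided by \<open>trace_form c c\<close>.\<close>

lemma reflect_lie_bracket:
  assumes "trace_form c c \<noteq> 0"
  shows "reflect c (lie_bracket y z) = lie_bracket (reflect c z) (reflect c y)"
proof -
  define k where "k u = 2 * trace_form c u / trace_form c c" for u
  have k: "2 * trace_form c u = trace_form c c * k u" for u
    using assms by (simp add: k_def)
  have "scale_sl2 (trace_form c c) (scale_sl2 2 (lie_bracket y z)) =
    scale_sl2 (2 * trace_form c y) (lie_bracket c z) - scale_sl2 (2 * trace_form c z) (lie_bracket c y)
    + scale_sl2 (2 * trace_form c (lie_bracket y z)) c"
    using arg_cong[OF lie_bracket_gram[of c y z], of "scale_sl2 2"]
    by (simp add: sl2.scale_right_distrib sl2.scale_right_diff_distrib mult.commute)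
  also have "\<dots> = scale_sl2 (trace_form c c) (scale_sl2 (k y) (lie_bracket c z)
    - scale_sl2 (k z) (lie_bracket c y) + scale_sl2 (k (lie_bracket y z)) c)"
    by (simp add: k sl2.scale_right_distrib sl2.scale_right_diff_distrib)
  finally have "scale_sl2 2 (lie_bracket y z) = scale_sl2 (k y) (lie_bracket c z)
    - scale_sl2 (k z) (lie_bracket c y) + scale_sl2 (k (lie_bracket y z)) c"
    using assms by (simp only: sl2.scale_cancel_left) blast
  then show ?thesis
    unfolding reflect_def k_def[symmetric] sl2_eq_iff mat_of_sl2_arith mat_of_sl2_lie_bracket
    by (intro conjI; algebra)
qed

lemma lie_antiautomorphism_reflect:
  assumes "trace_form c c \<noteq> 0"
  shows "lie_antiautomorphism (reflect c)"
proof -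
  have "Vector_Spaces.linear scale_sl2 scale_sl2 (reflect c)"
    by unfold_locales
      (simp_all add: reflect_def trace_form_linear add_divide_distrib algebra_simps
        sl2.scale_left_distrib sl2.scale_right_diff_distrib)
  moreover have "bij (reflect c)"
    using reflect_reflect[OF assms] by (metis bijI')
  ultimately show ?thesis
    using reflect_lie_bracket[OF assms] by (simp add: lie_antiautomorphism_def)
qed

text \<open>Closure is only required where \<open>f\<close> and \<open>g\<close> already agree, so
  bracket-reversing maps qualify too.\<close>

lemma lie_subalgebra_equalizer:
  assumes "Vector_Spaces.linear scale_sl2 scale_sl2 f" "Vector_Spaces.linear scale_sl2 scale_sl2 g"
    and "\<And>y z. f y = g y \<Longrightarrow> f z = g z \<Longrightarrow> f (lie_bracket y z) = g (lie_bracket y z)"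
  shows "lie_subalgebra {y. f y = g y}"
proof -
  interpret f: Vector_Spaces.linear scale_sl2 scale_sl2 f by fact
  interpret g: Vector_Spaces.linear scale_sl2 scale_sl2 g by fact
  show ?thesis
    using assms(3) by (simp add: lie_subalgebra_def sl2.subspace_def f.add g.add f.scale g.scale)
qed

lemma lie_antiautomorphism_eqI:
  assumes "lie_generates X" "lie_antiautomorphism \<sigma>" "lie_antiautomorphism \<tau>"
    and "\<And>x. x \<in> X \<Longrightarrow> \<sigma> x = \<tau> x"
  shows "\<sigma> = \<tau>"
proof -
  have "{y. \<sigma> y = \<tau> y} = UNIV"
    using assms
    by (intro lie_generates_induct[OF assms(1)] lie_subalgebra_equalizer)
      (auto simp: lie_antiautomorphism_def)
  then show ?thesis
    by auto
qed

theorem lemma2p22: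
  fixes a a' :: "'f::alg_closed_field sl2"
  assumes "CHAR('f) \<noteq> 2"
    and "semisimple a" and "normalized a"
    and "semisimple a'" and "normalized a'"
    and "lie_generates {a, a'}"
  shows "(\<exists>!\<sigma>. lie_antiautomorphism \<sigma> \<and> \<sigma> a = a \<and> \<sigma> a' = a') \<and>
    (\<forall>dagger. lie_antiautomorphism dagger \<and> dagger a = a \<and> dagger a' = a' \<longrightarrow>
      (\<forall>y. dagger (dagger y) = y))"
proof -
  let ?c = "lie_bracket a a'"
  have c: "trace_form ?c ?c \<noteq> 0"
    using assms by (intro trace_form_commutator_neq_0)
  have fixed: "reflect ?c a = a" "reflect ?c a' = a'"
    by (simp_all add: reflect_eq_self trace_form_lie_bracket)
  \<comment> \<open>Any such map is the reflection, which is involutive; this settles uniqueness and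
    the last claim together.\<close>
  have unique: "\<sigma> = reflect ?c"
    if "lie_antiautomorphism \<sigma>" "\<sigma> a = a" "\<sigma> a' = a'" for \<sigma>
    using that fixed lie_antiautomorphism_reflect[OF c]
    by (intro lie_antiautomorphism_eqI[OF assms(6)]) auto
  show ?thesis
    using unique fixed lie_antiautomorphism_reflect[OF c] reflect_reflect[OF c] by blast
qed

end
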